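(* Let $\Gamma$ be a countable sofic group with a sofic approximation $\Sigma$. For any factor map $\pi\colon X\to Y$ between dynamical systems $\Gamma\curvearrowright X$ and $\Gamma\curvearrowright Y$, we have $$\mathrm{mdim}_\Sigma(X)\le\mathrm{mdim}_\Sigma(X|Y)+\mathrm{mdim}_\Sigma(Y|X).$$
   Context: $\Gamma$ is a countable discrete group; $\mathcal F(\Gamma)$ is the collection of nonempty finite subsets of $\Gamma$. A dynamical system $\Gamma\curvearrowright X$ is a continuous action on a compact metrizable space $X$; a factor map is a surjective continuous $\Gamma$-equivariant map. $[d]=\{1,\dots,d\}$. A compatible metric is one inducing the topology. $\dim$ is covering dimension. Sofic approximation: a sequence of maps $\Sigma=\{\sigma_i\colon\Gamma\to\mathrm{Sym}(d_i)\}_{i\in\mathbb N}$ (not necessarily homomorphisms; write $\sigma_{i,s}=\sigma_i(s)$) with (1) $|\{v\in[d_i]:\sigma_{i,s}\sigma_{i,t}(v)=\sigma_{i,st}(v)\}|/d_i\to1$ for all $s,t\in\Gamma$; (2) $|\{v\in[d_i]:\sigma_{i,s}(v)\ne\sigma_{i,t}(v)\}|/d_i\to1$ for all distinct $s,t$; (3) $d_i\to\infty$. $\Gamma$ is sofic if it has a sofic approximation. For a continuous pseudometric $\rho$ on $Z$ and $\varphi,\psi\in Z^{[d]}$: $\rho_{2}(\varphi,\psi)=\big(\frac1d\sum_{v}\rho(\varphi(v),\psi(v))^2\big)^{1/2}$, $\rho_{\infty}(\varphi,\psi)=\max_v\rho(\varphi(v),\psi(v))$; these are written $\rho_{X,2},\rho_{X,\infty}$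 for $\rho=\rho_X$, etc. For $F\in\mathcal F(\Gamma)$, $\delta>0$, $\sigma\colon\Gamma\to\mathrm{Sym}(d)$, $$\mathrm{Map}(\rho_X,F,\delta,\sigma)=\{\varphi\colon[d]\to X:\ \rho_{X,2}(s\varphi,\varphi\circ\sigma(s))\le\delta\ \text{for all } s\in F\},\quad (s\varphi)(v)=s(\varphi(v)).$$ Let $\rho_X,\rho_Y$ be compatible metrics on $X,Y$. All quantities below are independent of this choice. In each of them the $\limsup$ is set to be $-\infty$ if the relevant $\mathrm{Map}$ sets are empty for all sufficiently large $i$. For $\mathcal K\subseteq X^{[d]}$ and $\varepsilon,\theta>0$, $\mathrm{Wdim}_\varepsilon(\mathcal K,\theta,\rho_{X,\infty}|\rho_{Y,\infty})$ is the minimal $\dim P$ over compact metrizable $P$ admitting a continuous $f\colon\mathcal K\to P$ such that $\rho_{X,\infty}(\varphi,\varphi')<\varepsilon$ whenever $f(\varphi)=f(\varphi')$ and $\rho_{Y,\infty}(\pi\circ\varphi,\pi\circ\varphi')\le\theta$. For a space $\mathcal K$ with a continuous pseudometric $\rho$, $\mathrm{Wdim}_\varepsilon(\mathcal K,\rho)$ is the minimal $\dim P$ over compact metrizable $P$ admitting a continuous $f\colon\mathcal K\to P$ with $\rho(\varphi,\varphi')<\varepsilon$ whenever $f(\varphi)=f(\varphi')$. $$\mathrm{mdim}_\Sigma(X|Y)=\sup_{\varepsilon>0}\inf_{\theta>0}\inf_{F\in\mathcal F(\Gamma)}\inf_{\delta>0}\limsup_{i\to\infty}\tfrac1{d_i}\mathrm{Wdim}_\varepsilon(\mathrm{Map}(\rho_X,F,\delta,\sigma_i),\theta,\rho_{X,\infty}|\rho_{Y,\infty}),$$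 $$\mathrm{mdim}_\Sigma(X)=\sup_{\varepsilon>0}\inf_{F\in\mathcal F(\Gamma)}\inf_{\delta>0}\limsup_{i\to\infty}\tfrac1{d_i}\mathrm{Wdim}_\varepsilon(\mathrm{Map}(\rho_X,F,\delta,\sigma_i),\rho_{X,\infty}),$$ $$\mathrm{mdim}_\Sigma(Y|X)=\sup_{\varepsilon>0}\inf_{F\in\mathcal F(\Gamma)}\inf_{\delta>0}\limsup_{i\to\infty}\tfrac1{d_i}\mathrm{Wdim}_\varepsilon(\pi^{d_i}(\mathrm{Map}(\rho_X,F,\delta,\sigma_i)),\rho_{Y,\infty}),$$ where $\pi^d\colon X^{[d]}\to Y^{[d]}$ sends $\varphi$ to $\pi\circ\varphi$. *)

theory Defs
  imports "HOL-Analysis.Analysis" "HOL-Algebra.Group_Action" "HOL-Combinatorics.Permutations"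
begin

section \<open>Dynamical systems and factor maps\<close>

definition dynamical_system ::
  "('g, 'm) monoid_scheme \<Rightarrow> 'x topology \<Rightarrow> ('g \<Rightarrow> 'x \<Rightarrow> 'x) \<Rightarrow> bool" where
  "dynamical_system G X \<alpha> \<longleftrightarrow>
     compact_space X \<and> metrizable_space X \<and>
     group_action G (topspace X) \<alpha> \<and>
     continuous_map (prod_topology (discrete_topology (carrier G)) X) X (\<lambda>(s, x). \<alpha> s x)"

definition factor_map ::
  "('g, 'm) monoid_scheme \<Rightarrow> 'x topology \<Rightarrow> ('g \<Rightarrow> 'x \<Rightarrow> 'x) \<Rightarrow>
   'y topology \<Rightarrow> ('g \<Rightarrow> 'y \<Rightarrow> 'y) \<Rightarrow> ('x \<Rightarrow> 'y) \<Rightarrow> bool" where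
  "factor_map G X \<alpha> Y \<beta> \<pi> \<longleftrightarrow>
     continuous_map X Y \<pi> \<and> \<pi> ` topspace X = topspace Y \<and>
     (\<forall>s\<in>carrier G. \<forall>x\<in>topspace X. \<pi> (\<alpha> s x) = \<beta> s (\<pi> x))"

definition compatible_metric :: "'x topology \<Rightarrow> ('x \<Rightarrow> 'x \<Rightarrow> real) \<Rightarrow> bool" where
  "compatible_metric X \<rho> \<longleftrightarrow>
     Metric_space (topspace X) \<rho> \<and> Metric_space.mtopology (topspace X) \<rho> = X"

section \<open>Sofic approximations\<close>

text \<open>\<open>[d]\<close> is \<open>{1..d}\<close>, and \<open>d i \<ge> 1\<close> because the definitions divide by \<open>d i\<close>.\<close>

definition sofic_approximation ::
  "('g, 'm) monoid_scheme \<Rightarrow> (nat \<Rightarrow> nat) \<Rightarrow> (nat \<Rightarrow> 'g \<Rightarrow> nat \<Rightarrow> nat) \<Rightarrow> bool" where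
  "sofic_approximation G d \<sigma> \<longleftrightarrow>
     (\<forall>i. d i \<ge> 1) \<and>
     (\<forall>i. \<forall>s\<in>carrier G. \<sigma> i s permutes {1..d i}) \<and>
     (\<forall>s\<in>carrier G. \<forall>t\<in>carrier G.
        (\<lambda>i. real (card {v\<in>{1..d i}. \<sigma> i s (\<sigma> i t v) = \<sigma> i (s \<otimes>\<^bsub>G\<^esub> t) v}) / real (d i))
          \<longlonglongrightarrow> 1) \<and>
     (\<forall>s\<in>carrier G. \<forall>t\<in>carrier G. s \<noteq> t \<longrightarrow>
        (\<lambda>i. real (card {v\<in>{1..d i}. \<sigma> i s v \<noteq> \<sigma> i t v}) / real (d i)) \<longlonglongrightarrow> 1) \<and>
     filterlim d at_top sequentially"

section \<open>Covering dimension and width dimension\<close>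

definition finite_open_cover :: "'a topology \<Rightarrow> 'a set set \<Rightarrow> bool" where
  "finite_open_cover X \<U> \<longleftrightarrow> finite \<U> \<and> (\<forall>U\<in>\<U>. openin X U) \<and> \<Union>\<U> = topspace X"

text \<open>\<open>k\<close> is the multiplicity of the refinement, so its order is \<open>k - 1\<close>. The value is
  \<open>\<infinity>\<close> if no \<open>k\<close> works for all covers, and \<open>-1\<close> for the empty space.\<close>

definition covering_dim :: "'a topology \<Rightarrow> ereal" where
  "covering_dim X =
     (INF k \<in> {k::nat. \<forall>\<U>. finite_open_cover X \<U> \<longrightarrow>
                 (\<exists>\<V>. finite_open_cover X \<V> \<and> (\<forall>V\<in>\<V>. \<exists>U\<in>\<U>. V \<subseteq> U) \<and>
                      (\<forall>x\<in>topspace X. card {V\<in>\<V>. x \<in> V} \<le> k))}.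
        ereal (real k - 1))"

text \<open>In the next two definitions \<open>P\<close> ranges over the compact metrizable topologies on subsets of
  the type \<open>nat \<Rightarrow> real\<close>. Up to homeomorphism these are all compact metrizable spaces, since each of
  them embeds in the Hilbert cube. A minimum over the empty set is \<open>\<infinity>\<close>.\<close>

definition Wdim :: "real \<Rightarrow> 'a topology \<Rightarrow> ('a \<Rightarrow> 'a \<Rightarrow> real) \<Rightarrow> ereal" where
  "Wdim \<epsilon> K \<rho> =
     (INF P \<in> {P :: (nat \<Rightarrow> real) topology. compact_space P \<and> metrizable_space P \<and>
                 (\<exists>f. continuous_map K P f \<and>
                      (\<forall>x\<in>topspace K. \<forall>y\<in>topspace K. f x = f y \<longrightarrow> \<rho> x y < \<epsilon>))}.
        covering_dim P)"

definition Wdim_rel ::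
  "real \<Rightarrow> 'a topology \<Rightarrow> real \<Rightarrow> ('a \<Rightarrow> 'a \<Rightarrow> real) \<Rightarrow> ('a \<Rightarrow> 'a \<Rightarrow> real) \<Rightarrow> ereal" where
  "Wdim_rel \<epsilon> K \<theta> \<rho> \<rho>' =
     (INF P \<in> {P :: (nat \<Rightarrow> real) topology. compact_space P \<and> metrizable_space P \<and>
                 (\<exists>f. continuous_map K P f \<and>
                      (\<forall>x\<in>topspace K. \<forall>y\<in>topspace K.
                         f x = f y \<and> \<rho>' x y \<le> \<theta> \<longrightarrow> \<rho> x y < \<epsilon>))}.
        covering_dim P)"

section \<open>Microstates\<close>

definition dist2 :: "('z \<Rightarrow> 'z \<Rightarrow> real) \<Rightarrow> nat \<Rightarrow> (nat \<Rightarrow> 'z) \<Rightarrow> (nat \<Rightarrow> 'z) \<Rightarrow> real" where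
  "dist2 \<rho> d \<phi> \<psi> = sqrt (1 / real d * (\<Sum>v=1..d. (\<rho> (\<phi> v) (\<psi> v))\<^sup>2))"

definition dist_inf :: "('z \<Rightarrow> 'z \<Rightarrow> real) \<Rightarrow> nat \<Rightarrow> (nat \<Rightarrow> 'z) \<Rightarrow> (nat \<Rightarrow> 'z) \<Rightarrow> real" where
  "dist_inf \<rho> d \<phi> \<psi> = Max ((\<lambda>v. \<rho> (\<phi> v) (\<psi> v)) ` {1..d})"

text \<open>\<open>X\<close> to the power \<open>[d]\<close>; its points are the extensional functions on \<open>{1..d}\<close>.\<close>

abbreviation power_space :: "'z topology \<Rightarrow> nat \<Rightarrow> (nat \<Rightarrow> 'z) topology" where
  "power_space Z d \<equiv> product_topology (\<lambda>_. Z) {1..d}"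

definition Map_set ::
  "'x topology \<Rightarrow> ('g \<Rightarrow> 'x \<Rightarrow> 'x) \<Rightarrow> ('x \<Rightarrow> 'x \<Rightarrow> real) \<Rightarrow> 'g set \<Rightarrow> real \<Rightarrow>
   nat \<Rightarrow> ('g \<Rightarrow> nat \<Rightarrow> nat) \<Rightarrow> (nat \<Rightarrow> 'x) set" where
  "Map_set X \<alpha> \<rho> F \<delta> d \<sigma> =
     {\<phi> \<in> {1..d} \<rightarrow>\<^sub>E topspace X. \<forall>s\<in>F. dist2 \<rho> d (\<lambda>v. \<alpha> s (\<phi> v)) (\<phi> \<circ> \<sigma> s) \<le> \<delta>}"

definition fin_subsets :: "('g, 'm) monoid_scheme \<Rightarrow> 'g set set" where
  "fin_subsets G = {F. F \<subseteq> carrier G \<and> finite F \<and> F \<noteq> {}}"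

section \<open>Sofic mean dimensions\<close>

definition limsup_Map :: "(nat \<Rightarrow> 'k set) \<Rightarrow> (nat \<Rightarrow> ereal) \<Rightarrow> ereal" where
  "limsup_Map K w = (if \<forall>\<^sub>F i in sequentially. K i = {} then - \<infinity> else limsup w)"

definition mdim ::
  "('g, 'm) monoid_scheme \<Rightarrow> (nat \<Rightarrow> nat) \<Rightarrow> (nat \<Rightarrow> 'g \<Rightarrow> nat \<Rightarrow> nat) \<Rightarrow>
   'x topology \<Rightarrow> ('g \<Rightarrow> 'x \<Rightarrow> 'x) \<Rightarrow> ('x \<Rightarrow> 'x \<Rightarrow> real) \<Rightarrow> ereal" where
  "mdim G d \<sigma> X \<alpha> \<rho>X =
     (SUP \<epsilon>\<in>{0<..}. INF F\<in>fin_subsets G. INF \<delta>\<in>{0<..}.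
        limsup_Map (\<lambda>i. Map_set X \<alpha> \<rho>X F \<delta> (d i) (\<sigma> i))
          (\<lambda>i. ereal (1 / real (d i)) *
             Wdim \<epsilon>
               (subtopology (power_space X (d i)) (Map_set X \<alpha> \<rho>X F \<delta> (d i) (\<sigma> i)))
               (dist_inf \<rho>X (d i))))"

text \<open>The mean dimension of \<open>X\<close> relative to \<open>Y\<close>, written \<open>mdim(X|Y)\<close>.\<close>

definition mdim_rel ::
  "('g, 'm) monoid_scheme \<Rightarrow> (nat \<Rightarrow> nat) \<Rightarrow> (nat \<Rightarrow> 'g \<Rightarrow> nat \<Rightarrow> nat) \<Rightarrow>
   'x topology \<Rightarrow> ('g \<Rightarrow> 'x \<Rightarrow> 'x) \<Rightarrow> ('x \<Rightarrow> 'x \<Rightarrow> real) \<Rightarrow>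
   ('y \<Rightarrow> 'y \<Rightarrow> real) \<Rightarrow> ('x \<Rightarrow> 'y) \<Rightarrow> ereal" where
  "mdim_rel G d \<sigma> X \<alpha> \<rho>X \<rho>Y \<pi> =
     (SUP \<epsilon>\<in>{0<..}. INF \<theta>\<in>{0<..}. INF F\<in>fin_subsets G. INF \<delta>\<in>{0<..}.
        limsup_Map (\<lambda>i. Map_set X \<alpha> \<rho>X F \<delta> (d i) (\<sigma> i))
          (\<lambda>i. ereal (1 / real (d i)) *
             Wdim_rel \<epsilon>
               (subtopology (power_space X (d i)) (Map_set X \<alpha> \<rho>X F \<delta> (d i) (\<sigma> i)))
               \<theta> (dist_inf \<rho>X (d i)) (\<lambda>\<phi> \<psi>. dist_inf \<rho>Y (d i) (\<pi> \<circ> \<phi>) (\<pi> \<circ> \<psi>))))"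

text \<open>The mean dimension of \<open>Y\<close> relative to the extension \<open>X\<close>, written \<open>mdim(Y|X)\<close>: only the
  microstates of \<open>Y\<close> that lift to microstates of \<open>X\<close> count. The map \<open>compose {1..d} \<pi>\<close> is
  \<open>\<phi> \<mapsto> \<pi> \<circ> \<phi>\<close>, restricted to \<open>{1..d}\<close> so that its values are extensional.\<close>

definition mdim_ext ::
  "('g, 'm) monoid_scheme \<Rightarrow> (nat \<Rightarrow> nat) \<Rightarrow> (nat \<Rightarrow> 'g \<Rightarrow> nat \<Rightarrow> nat) \<Rightarrow>
   'x topology \<Rightarrow> ('g \<Rightarrow> 'x \<Rightarrow> 'x) \<Rightarrow> ('x \<Rightarrow> 'x \<Rightarrow> real) \<Rightarrow>
   'y topology \<Rightarrow> ('y \<Rightarrow> 'y \<Rightarrow> real) \<Rightarrow> ('x \<Rightarrow> 'y) \<Rightarrow> ereal" where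
  "mdim_ext G d \<sigma> X \<alpha> \<rho>X Y \<rho>Y \<pi> =
     (SUP \<epsilon>\<in>{0<..}. INF F\<in>fin_subsets G. INF \<delta>\<in>{0<..}.
        limsup_Map (\<lambda>i. Map_set X \<alpha> \<rho>X F \<delta> (d i) (\<sigma> i))
          (\<lambda>i. ereal (1 / real (d i)) *
             Wdim \<epsilon>
               (subtopology (power_space Y (d i))
                  (compose {1..d i} \<pi> ` Map_set X \<alpha> \<rho>X F \<delta> (d i) (\<sigma> i)))
               (dist_inf \<rho>Y (d i))))"

end

theory Submission
  imports Defs
begin

text \<open>A map \<open>f\<close> to \<open>P\<close> witnessing the relative width dimension at \<open>(\<epsilon>, \<theta>)\<close> and a map \<open>g\<close> to
  \<open>Q\<close> witnessing the width dimension of the projected microstates at \<open>\<theta>\<close> combine to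
  \<open>\<phi> \<mapsto> (f \<phi>, g (\<pi> \<circ> \<phi>))\<close>, which separates microstates at scale \<open>\<epsilon>\<close>. So everything rests
  on \<open>dim (P \<times> Q) \<le> dim P + dim Q\<close> for compact metrizable \<open>P\<close> and \<open>Q\<close>. That inequality is
  obtained from covers of \<open>P\<close> and \<open>Q\<close> by refining their product cover as in the barycentric
  subdivision: weight functions on both factors are compared with each other at every point.\<close>

section \<open>Sums of infima in the extended reals\<close>

text \<open>If one infimum is \<open>\<infinity>\<close>, for instance because the set is empty,
  then so is the sum. Otherwise the lower bound \<open>c\<close> makes both infima real, and each is
  approximated up to \<open>e / 2\<close>. All later uses take \<open>c = - 1\<close>, the smallest
  possible covering dimension.\<close>

lemma le_Inf_add_Inf:
  fixes A B :: "ereal set" and c :: real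
  assumes le: "\<And>a b. \<lbrakk>a \<in> A; b \<in> B\<rbrakk> \<Longrightarrow> m \<le> a + b"
    and A: "\<And>a. a \<in> A \<Longrightarrow> ereal c \<le> a" and B: "\<And>b. b \<in> B \<Longrightarrow> ereal c \<le> b"
  shows "m \<le> Inf A + Inf B"
proof (cases "Inf A = \<infinity> \<or> Inf B = \<infinity>")
  case False
  moreover have "ereal c \<le> Inf A" "ereal c \<le> Inf B"
    using A B by (auto intro: Inf_greatest)
  ultimately obtain a b where ab: "Inf A = ereal a" "Inf B = ereal b"
    by (cases "Inf A"; cases "Inf B") auto
  show ?thesis
  proof (rule ereal_le_epsilon2)
    fix e :: real assume "0 < e"
    then have "Inf A < ereal (a + e / 2)" "Inf B < ereal (b + e / 2)"
      using ab by auto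
    then obtain x y where "x \<in> A" "x < ereal (a + e / 2)" "y \<in> B" "y < ereal (b + e / 2)"
      by (auto simp: Inf_less_iff)
    then have "m \<le> ereal (a + e / 2) + ereal (b + e / 2)"
      by (meson add_mono le less_imp_le order_trans)
    then show "m \<le> Inf A + Inf B + ereal e"
      by (simp add: ab algebra_simps)
  qed
qed auto

section \<open>Cozero functions and refinement of product covers\<close>

text \<open>The distance to the complement of \<open>U\<close> is such a function. It is positive at
  \<open>x\<close> exactly if some ball around \<open>x\<close> stays inside \<open>U\<close>, and
  the triangle inequality makes it 1-Lipschitz.\<close>

lemma metrizable_space_cozero:
  assumes "metrizable_space X" and U: "openin X U"
  shows "\<exists>f. continuous_map X euclideanreal f \<and> (\<forall>x\<in>topspace X. 0 \<le> f x \<and> (0 < f x \<longleftrightarrow> x \<in> U))"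
proof -
  obtain M D where MD: "Metric_space M D" and X: "X = Metric_space.mtopology M D"
    using assms(1) by (auto simp: metrizable_space_def)
  interpret Metric_space M D by fact
  show ?thesis
  proof (cases "U = M")
    \<comment> \<open>Here the complement is empty, and the real infimum over it would say
      nothing.\<close>
    case True
    then show ?thesis
      by (intro exI[of _ "\<lambda>_. 1"]) (auto simp: X)
  next
    case False
    have UM: "U \<subseteq> M" using U X openin_mtopology by auto
    define f where "f x = (INF y \<in> M - U. D x y)" for x
    have ne: "M - U \<noteq> {}" using False UM by auto
    have bdd: "bdd_below (D x ` (M - U))" for x
      by (intro bdd_belowI[of _ 0]) auto
    have nonneg: "0 \<le> f x" for x
      unfolding f_def using ne by (intro cINF_greatest) auto
    have pos: "0 < f x \<longleftrightarrow> x \<in> U" if x: "x \<in> M" for x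
    proof
      assume "x \<in> U"
      then obtain r where r: "r > 0" "mball x r \<subseteq> U"
        using U by (auto simp: X openin_mtopology)
      have "r \<le> f x"
        unfolding f_def
      proof (intro cINF_greatest ne)
        fix y assume "y \<in> M - U"
        then show "r \<le> D x y" using r x by (metis DiffE in_mball not_le subsetD)
      qed
      then show "0 < f x" using r by linarith
    next
      assume "0 < f x"
      show "x \<in> U"
      proof (rule ccontr)
        assume "x \<notin> U"
        then have "f x \<le> D x x" unfolding f_def using x by (intro cINF_lower bdd) auto
        with \<open>0 < f x\<close> x show False by simp
      qed
    qed
    have lip: "f x \<le> f y + D x y" if "x \<in> M" "y \<in> M" for x y
    proof -
      have "f x - D x y \<le> f y"
        unfolding f_def[of y]
      proof (intro cINF_greatest ne)
        fix z assume z: "z \<in> M - U"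
        have "f x \<le> D x z" unfolding f_def using z by (intro cINF_lower bdd) auto
        also have "\<dots> \<le> D x y + D y z" using that z triangle by auto
        finally show "f x - D x y \<le> D y z" by simp
      qed
      then show ?thesis by simp
    qed
    have "continuous_map mtopology euclideanreal f"
      unfolding continuous_map_from_metric
    proof (intro conjI ballI allI impI)
      fix a V assume a: "a \<in> M" and "openin euclideanreal V \<and> f a \<in> V"
      then obtain e where e: "e > 0" "\<And>y. dist y (f a) < e \<Longrightarrow> y \<in> V"
        by (auto simp: open_dist)
      have "f x \<in> V" if "x \<in> M" "D a x < e" for x
        using lip[OF a that(1)] lip[OF that(1) a] that commute[of a x]
        by (intro e(2)) (auto simp: dist_real_def abs_less_iff)
      then show "\<exists>r>0. \<forall>x. x \<in> M \<and> D a x < r \<longrightarrow> f x \<in> V"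
        using e(1) by blast
    qed auto
    then show ?thesis
      using nonneg pos by (auto simp: X)
  qed
qed

lemma openin_less_continuous_map:
  assumes "continuous_map X euclideanreal f" "continuous_map X euclideanreal g"
  shows "openin X {x \<in> topspace X. f x < g x}"
proof -
  have "openin X {x \<in> topspace X. g x - f x \<in> {0<..}}"
    using assms by (intro openin_continuous_map_preimage[of _ euclideanreal] continuous_map_diff) auto
  then show ?thesis by simp
qed

lemma finite_open_cover_cozero:
  assumes "metrizable_space X" "finite_open_cover X \<U>"
  obtains f where "\<And>U. U \<in> \<U> \<Longrightarrow> continuous_map X euclideanreal (f U)"
    "\<And>U x. \<lbrakk>U \<in> \<U>; x \<in> topspace X\<rbrakk> \<Longrightarrow> 0 \<le> f U x"
    "\<And>U x. \<lbrakk>U \<in> \<U>; x \<in> topspace X\<rbrakk> \<Longrightarrow> 0 < f U x \<longleftrightarrow> x \<in> U"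
proof -
  have "\<forall>U\<in>\<U>. \<exists>f. continuous_map X euclideanreal f \<and> (\<forall>x\<in>topspace X. 0 \<le> f x \<and> (0 < f x \<longleftrightarrow> x \<in> U))"
    using assms by (auto simp: finite_open_cover_def intro: metrizable_space_cozero)
  then obtain f where "\<forall>U\<in>\<U>. continuous_map X euclideanreal (f U) \<and>
      (\<forall>x\<in>topspace X. 0 \<le> f U x \<and> (0 < f U x \<longleftrightarrow> x \<in> U))"
    by metis
  then show ?thesis by (intro that) auto
qed

text \<open>A point is assigned to the pairs \<open>(S, T)\<close> of index sets for which it separates the
  coordinates in \<open>S \<union> T\<close> from the remaining ones. For a fixed point these sets form a chain, so
  there is at most one pair of each cardinality, and the cardinalities that occur lie between \<open>2\<close>
  and \<open>k + l\<close>.\<close>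

lemma finite_open_cover_prod_refinement:
  assumes P: "metrizable_space P" and Q: "metrizable_space Q"
    and \<U>: "finite_open_cover P \<U>" and \<V>: "finite_open_cover Q \<V>"
    and k: "\<And>x. x \<in> topspace P \<Longrightarrow> card {U\<in>\<U>. x \<in> U} \<le> k"
    and l: "\<And>y. y \<in> topspace Q \<Longrightarrow> card {V\<in>\<V>. y \<in> V} \<le> l"
  shows "\<exists>\<W>. finite_open_cover (prod_topology P Q) \<W> \<and>
    (\<forall>W\<in>\<W>. \<exists>U\<in>\<U>. \<exists>V\<in>\<V>. W \<subseteq> U \<times> V) \<and>
    (\<forall>z\<in>topspace (prod_topology P Q). card {W\<in>\<W>. z \<in> W} \<le> k + l - 1)"
proof -
  let ?Z = "topspace (prod_topology P Q)"
  obtain f where f: "\<And>U. U \<in> \<U> \<Longrightarrow> continuous_map P euclideanreal (f U)"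
    "\<And>U x. \<lbrakk>U \<in> \<U>; x \<in> topspace P\<rbrakk> \<Longrightarrow> 0 \<le> f U x"
    "\<And>U x. \<lbrakk>U \<in> \<U>; x \<in> topspace P\<rbrakk> \<Longrightarrow> 0 < f U x \<longleftrightarrow> x \<in> U"
    using finite_open_cover_cozero[OF P \<U>] by metis
  obtain g where g: "\<And>V. V \<in> \<V> \<Longrightarrow> continuous_map Q euclideanreal (g V)"
    "\<And>V y. \<lbrakk>V \<in> \<V>; y \<in> topspace Q\<rbrakk> \<Longrightarrow> 0 \<le> g V y"
    "\<And>V y. \<lbrakk>V \<in> \<V>; y \<in> topspace Q\<rbrakk> \<Longrightarrow> 0 < g V y \<longleftrightarrow> y \<in> V"
    using finite_open_cover_cozero[OF Q \<V>] by metis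
  \<comment> \<open>The disjoint sum puts the weights of both covers into one family
    \<open>h\<close> on the product, so that weights from different factors can be compared.\<close>
  define I where "I = \<U> <+> \<V>"
  define h where "h = case_sum (\<lambda>U. f U \<circ> fst) (\<lambda>V. g V \<circ> snd)"
  \<comment> \<open>An index of each kind is required so that \<open>w A\<close> lies in some box
    \<open>U \<times> V\<close>.\<close>
  define adm where "adm = {A. A \<subseteq> I \<and> A \<inter> range Inl \<noteq> {} \<and> A \<inter> range Inr \<noteq> {}}"
  define w where "w A = {z \<in> ?Z. \<forall>a\<in>A. 0 < h a z \<and> (\<forall>b\<in>I - A. h b z < h a z)}" for A
  define pos where "pos z = {a \<in> I. 0 < h a z}" for z
  have fin: "finite \<U>" "finite \<V>" "finite I"
    using \<U> \<V> by (auto simp: finite_open_cover_def I_def)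
  have finadm: "finite adm"
    unfolding adm_def by (rule finite_subset[of _ "Pow I"]) (use fin in auto)
  have h_cont: "continuous_map (prod_topology P Q) euclideanreal (h a)" if "a \<in> I" for a
    using that f(1) g(1)
    by (auto simp: I_def h_def intro!: continuous_map_compose[of _ P] continuous_map_compose[of _ Q]
        continuous_map_fst continuous_map_snd)
  have h_nonneg: "0 \<le> h a z" if "a \<in> I" "z \<in> ?Z" for a z
    using that f(2) g(2) by (auto simp: I_def h_def)
  have pos_eq: "pos z = {U\<in>\<U>. fst z \<in> U} <+> {V\<in>\<V>. snd z \<in> V}" if "z \<in> ?Z" for z
    using that f(3) g(3) by (auto simp: pos_def I_def h_def)
  have open_w: "openin (prod_topology P Q) (w A)" if "A \<subseteq> I" for A
  proof -
    have finA: "finite A" using that fin finite_subset by blast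
    \<comment> \<open>The repeated intersections with the whole space cover the cases of empty
      \<open>A\<close> or empty \<open>I - A\<close>, where the indexed intersection is
      \<open>UNIV\<close>.\<close>
    have "openin (prod_topology P Q)
      (topspace (prod_topology P Q) \<inter> (\<Inter>a\<in>A. {z \<in> ?Z. 0 < h a z} \<inter> 
         (?Z \<inter> (\<Inter>b\<in>I - A. {z \<in> ?Z. h b z < h a z}))))"
      using that fin finA h_cont
      by (cases "A = {}"; cases "I - A = {}")
        (auto intro!: openin_Int openin_Inter openin_less_continuous_map simp del: topspace_prod_topology)
    also have "\<dots> = w A" by (auto simp: w_def)
    finally show ?thesis .
  qed
  have w_subset: "\<exists>U\<in>\<U>. \<exists>V\<in>\<V>. w A \<subseteq> U \<times> V" if A: "A \<in> adm" for A
  proof -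
    obtain U V where UV: "Inl U \<in> A" "Inr V \<in> A"
      using A by (auto simp: adm_def)
    moreover have "A \<subseteq> I" using A by (simp add: adm_def)
    ultimately have "U \<in> \<U>" "V \<in> \<V>" by (auto simp: I_def)
    moreover from UV this have "w A \<subseteq> U \<times> V"
      using f(3) g(3) by (force simp: w_def h_def)
    ultimately show ?thesis by blast
  qed
  have cover: "z \<in> w (pos z)" "pos z \<in> adm" if z: "z \<in> ?Z" for z
  proof -
    \<comment> \<open>Since every weight outside \<open>pos z\<close> vanishes at \<open>z\<close>,
      the set \<open>pos z\<close> is itself separated from its complement by
      \<open>z\<close>.\<close>
    have "h b z = 0" if "b \<in> I - pos z" for b
      using h_nonneg[of b z] that z by (force simp: pos_def)
    then show "z \<in> w (pos z)"
      using z by (auto simp: w_def pos_def)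
    obtain U V where "U \<in> \<U>" "fst z \<in> U" "V \<in> \<V>" "snd z \<in> V"
    proof -
      have "fst z \<in> \<Union>\<U>" "snd z \<in> \<Union>\<V>"
        using z \<U> \<V> by (auto simp: finite_open_cover_def)
      then show thesis using that by blast
    qed
    then have "Inl U \<in> pos z" "Inr V \<in> pos z"
      unfolding pos_eq[OF z] by blast+
    moreover have "pos z \<subseteq> I" by (auto simp: pos_def)
    ultimately show "pos z \<in> adm" by (auto simp: adm_def)
  qed
  have mult: "card {W \<in> w ` adm. z \<in> W} \<le> k + l - 1" if z: "z \<in> ?Z" for z
  proof -
    define J where "J = {A \<in> adm. z \<in> w A}"
    have finJ: "finite J" using finadm by (simp add: J_def)
    have "inj_on card J"
    proof (rule inj_onI, rule ccontr)
      fix A B assume AB: "A \<in> J" "B \<in> J" "card A = card B" "A \<noteq> B"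
      then have "A \<subseteq> I" "B \<subseteq> I" by (auto simp: J_def adm_def)
      then have "finite A" "finite B" using fin finite_subset by blast+
      then have "\<not> A \<subseteq> B" "\<not> B \<subseteq> A" using AB card_subset_eq by metis+
      \<comment> \<open>Two incomparable sets would force \<open>a\<close> and \<open>b\<close> to
        have strictly larger weight than each other; hence the sets in \<open>J\<close> form a
        chain.\<close>
      then obtain a b where ab: "a \<in> A" "a \<notin> B" "b \<in> B" "b \<notin> A" by blast
      then have "h b z < h a z" "h a z < h b z"
        using AB \<open>A \<subseteq> I\<close> \<open>B \<subseteq> I\<close> by (auto simp: J_def w_def)
      then show False by simp
    qed
    moreover have "card ` J \<subseteq> {2..k + l}"
    proof clarify
      fix A assume A: "A \<in> J"
      then obtain U V where UV: "Inl U \<in> A" "Inr V \<in> A" by (auto simp: J_def adm_def)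
      have "A \<subseteq> pos z" using A by (auto simp: J_def adm_def w_def pos_def)
      moreover have fpos: "finite (pos z)" using fin by (simp add: pos_def)
      ultimately have "finite A" "card A \<le> card (pos z)"
        by (auto intro: finite_subset card_mono)
      moreover have "card (pos z) \<le> k + l"
        using k[of "fst z"] l[of "snd z"] z fin by (auto simp: pos_eq[OF z] card_Plus)
      moreover have "card {Inl U, Inr V} \<le> card A"
        using UV \<open>finite A\<close> by (intro card_mono) auto
      ultimately show "card A \<in> {2..k + l}" by simp
    qed
    \<comment> \<open>This interval has \<open>k + l - 1\<close> elements, also for
      \<open>k + l < 2\<close>, where it is empty and the natural subtraction gives 0.\<close>
    ultimately have "card J \<le> card {2..k + l}"
      by (metis card_image card_mono finite_atLeastAtMost)
    moreover have "{W \<in> w ` adm. z \<in> W} = w ` J" by (auto simp: J_def)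
    ultimately show ?thesis
      using card_image_le[OF finJ, of w] by simp
  qed
  have "finite_open_cover (prod_topology P Q) (w ` adm)"
    unfolding finite_open_cover_def
  proof (intro conjI ballI)
    show "\<Union> (w ` adm) = ?Z" using cover by (fastforce simp: w_def)
  qed (use finadm open_w in \<open>auto simp: adm_def\<close>)
  then show ?thesis
    using w_subset mult by (intro exI[of _ "w ` adm"]) blast
qed


section \<open>Covers of a compact product by boxes\<close>

lemma compact_metrizable_ball_cover:
  assumes "Metric_space M D" "compact_space (Metric_space.mtopology M D)" "0 < r"
  shows "\<exists>K\<subseteq>M. finite_open_cover (Metric_space.mtopology M D) ((\<lambda>x. Metric_space.mball M D x r) ` K)"
proof -
  interpret Metric_space M D by fact
  have "mtotally_bounded M"
    using assms(2) by (simp add: compactin_imp_mtotally_bounded compact_space_def)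
  then obtain K where K: "finite K" "K \<subseteq> M" "M \<subseteq> (\<Union>x\<in>K. mball x r)"
    using \<open>0 < r\<close> unfolding mtotally_bounded_def by meson
  then show ?thesis
    by (intro exI[of _ K]) (auto simp: finite_open_cover_def)
qed

text \<open>Let \<open>r\<close> be a Lebesgue number of the cover for the product metric. A product
  of two balls of radius \<open>r / 2\<close> lies in a ball of radius \<open>r\<close>, hence in a
  member of the cover, and finitely many such balls cover each factor.\<close>

lemma finite_open_cover_prod_boxes:
  assumes P: "compact_space P" "metrizable_space P" and Q: "compact_space Q" "metrizable_space Q"
    and \<W>: "finite_open_cover (prod_topology P Q) \<W>"
  shows "\<exists>\<U> \<V>. finite_open_cover P \<U> \<and> finite_open_cover Q \<V> \<and>
    (\<forall>U\<in>\<U>. \<forall>V\<in>\<V>. \<exists>W\<in>\<W>. U \<times> V \<subseteq> W)"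
proof -
  obtain M D where M: "Metric_space M D" and Peq: "P = Metric_space.mtopology M D"
    using P(2) by (auto simp: metrizable_space_def)
  obtain N E where N: "Metric_space N E" and Qeq: "Q = Metric_space.mtopology N E"
    using Q(2) by (auto simp: metrizable_space_def)
  interpret Metric_space12 M D N E
    using M N by (simp add: Metric_space12_def)
  have PQ: "prod_topology P Q = Prod_metric.mtopology"
    by (simp add: Peq Qeq mtopology_prod_metric)
  have "compactin Prod_metric.mtopology (M \<times> N)"
    using P(1) Q(1) compact_space_prod_topology[of P Q] PQ
    by (metis Prod_metric.topspace_mtopology compact_space_def)
  moreover have "M \<times> N \<subseteq> \<Union>\<W>" and "\<And>W. W \<in> \<W> \<Longrightarrow> openin Prod_metric.mtopology W"
    using \<W> by (auto simp: finite_open_cover_def PQ)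
  ultimately obtain r where r: "r > 0" "\<And>z. z \<in> M \<times> N \<Longrightarrow> \<exists>W\<in>\<W>. Prod_metric.mball z r \<subseteq> W"
    using Prod_metric.lebesgue_number by metis
  obtain K where K: "K \<subseteq> M" "finite_open_cover P ((\<lambda>x. M1.mball x (r / 2)) ` K)"
    using compact_metrizable_ball_cover[OF M, of "r / 2"] P(1) r(1) Peq by auto
  obtain L where L: "L \<subseteq> N" "finite_open_cover Q ((\<lambda>y. M2.mball y (r / 2)) ` L)"
    using compact_metrizable_ball_cover[OF N, of "r / 2"] Q(1) r(1) Qeq by auto
  have "\<exists>W\<in>\<W>. M1.mball x (r / 2) \<times> M2.mball y (r / 2) \<subseteq> W" if "x \<in> K" "y \<in> L" for x y
  proof -
    have "(x, y) \<in> M \<times> N" using that K L by auto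
    from r(2)[OF this] obtain W where "W \<in> \<W>" "Prod_metric.mball (x, y) r \<subseteq> W" by blast
    moreover have "M1.mball x (r / 2) \<times> M2.mball y (r / 2) \<subseteq> Prod_metric.mball (x, y) r"
      using mball_subset_prod_metric[of x "r / 2" y "r / 2"] by simp
    ultimately show ?thesis by blast
  qed
  with K L show ?thesis by blast
qed

section \<open>Covering dimension of products\<close>

text \<open>The condition under the infimum in \<open>covering_dim\<close>: covering dimension at
  most \<open>k - 1\<close>, with \<open>k = 0\<close> reserved for the empty space.\<close>

definition refinable :: "'a topology \<Rightarrow> nat \<Rightarrow> bool" where
  "refinable X k \<longleftrightarrow> (\<forall>\<U>. finite_open_cover X \<U> \<longrightarrow>
     (\<exists>\<V>. finite_open_cover X \<V> \<and> (\<forall>V\<in>\<V>. \<exists>U\<in>\<U>. V \<subseteq> U) \<and>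
          (\<forall>x\<in>topspace X. card {V\<in>\<V>. x \<in> V} \<le> k)))"

lemma covering_dim_eq: "covering_dim X = (INF k\<in>{k. refinable X k}. ereal (real k - 1))"
  by (simp add: covering_dim_def refinable_def)

lemma covering_dim_ge: "- 1 \<le> covering_dim X"
  unfolding covering_dim_eq by (intro INF_greatest) (auto simp: one_ereal_def)

lemma covering_dim_le: "refinable X k \<Longrightarrow> covering_dim X \<le> ereal (real k - 1)"
  unfolding covering_dim_eq by (auto intro: INF_lower)

text \<open>A cover is first refined by boxes, then the two factors are refined separately, and the
  results are recombined. In terms of dimension, \<open>k + l - 1\<close> stands for the sum of
  \<open>k - 1\<close> and \<open>l - 1\<close>.\<close>

lemma refinable_prod:
  assumes P: "compact_space P" "metrizable_space P" "refinable P k"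
    and Q: "compact_space Q" "metrizable_space Q" "refinable Q l"
  shows "refinable (prod_topology P Q) (k + l - 1)"
  unfolding refinable_def
proof (intro allI impI)
  fix \<W> assume "finite_open_cover (prod_topology P Q) \<W>"
  then obtain \<U> \<V> where UV: "finite_open_cover P \<U>" "finite_open_cover Q \<V>"
    and box: "\<And>U V. \<lbrakk>U \<in> \<U>; V \<in> \<V>\<rbrakk> \<Longrightarrow> \<exists>W\<in>\<W>. U \<times> V \<subseteq> W"
    using finite_open_cover_prod_boxes P Q by metis
  obtain \<U>' where U': "finite_open_cover P \<U>'" "\<forall>U\<in>\<U>'. \<exists>U'\<in>\<U>. U \<subseteq> U'"
    "\<forall>x\<in>topspace P. card {U\<in>\<U>'. x \<in> U} \<le> k"
    using P(3) UV(1) unfolding refinable_def by meson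
  obtain \<V>' where V': "finite_open_cover Q \<V>'" "\<forall>V\<in>\<V>'. \<exists>V'\<in>\<V>. V \<subseteq> V'"
    "\<forall>y\<in>topspace Q. card {V\<in>\<V>'. y \<in> V} \<le> l"
    using Q(3) UV(2) unfolding refinable_def by meson
  obtain \<W>' where W': "finite_open_cover (prod_topology P Q) \<W>'"
    "\<forall>W\<in>\<W>'. \<exists>U\<in>\<U>'. \<exists>V\<in>\<V>'. W \<subseteq> U \<times> V"
    "\<forall>z\<in>topspace (prod_topology P Q). card {W\<in>\<W>'. z \<in> W} \<le> k + l - 1"
    using finite_open_cover_prod_refinement[OF P(2) Q(2) U'(1) V'(1), of k l] U'(3) V'(3) by blast
  have "\<exists>W'\<in>\<W>. W \<subseteq> W'" if W: "W \<in> \<W>'" for W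
  proof -
    obtain U V where "U \<in> \<U>'" "V \<in> \<V>'" "W \<subseteq> U \<times> V" using W'(2) W by meson
    moreover from this obtain U1 V1 where "U1 \<in> \<U>" "U \<subseteq> U1" "V1 \<in> \<V>" "V \<subseteq> V1"
      using U'(2) V'(2) by meson
    moreover from this obtain W1 where "W1 \<in> \<W>" "U1 \<times> V1 \<subseteq> W1" using box by meson
    ultimately show ?thesis by blast
  qed
  then show "\<exists>\<V>. finite_open_cover (prod_topology P Q) \<V> \<and> (\<forall>V\<in>\<V>. \<exists>U\<in>\<W>. V \<subseteq> U) \<and>
      (\<forall>x\<in>topspace (prod_topology P Q). card {V \<in> \<V>. x \<in> V} \<le> k + l - 1)"
    using W' by blast
qed

text \<open>For nonempty \<open>P\<close> and \<open>Q\<close> the summand \<open>1\<close> is not needed. It pays for the dimension \<open>-1\<close>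
  of the empty space and disappears after division by \<open>d i\<close>.\<close>

lemma covering_dim_prod_le:
  assumes "compact_space P" "metrizable_space P" "compact_space Q" "metrizable_space Q"
  shows "covering_dim (prod_topology P Q) \<le> covering_dim P + covering_dim Q + 1"
proof -
  have "covering_dim (prod_topology P Q) - 1 \<le> covering_dim P + covering_dim Q"
    unfolding covering_dim_eq[of P] covering_dim_eq[of Q]
  proof (rule le_Inf_add_Inf[where c = "- 1"]; clarify)
    fix k l assume "refinable P k" "refinable Q l"
    then have "covering_dim (prod_topology P Q) \<le> ereal (real (k + l - 1) - 1)"
      using assms by (intro covering_dim_le refinable_prod)
    \<comment> \<open>For \<open>k = l = 0\<close> the natural subtraction truncates, and both sides
      equal -1.\<close>
    also have "\<dots> \<le> ereal (real k - 1) + ereal (real l - 1) + 1"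
      by (simp add: one_ereal_def)
    finally show "covering_dim (prod_topology P Q) - 1 \<le> ereal (real k - 1) + ereal (real l - 1)"
      by (simp add: ereal_minus_le)
  qed auto
  then show ?thesis by (simp add: ereal_minus_le)
qed

section \<open>Homeomorphism invariance and transport of topologies\<close>

lemma homeomorphic_map_finite_open_cover:
  assumes h: "homeomorphic_map X Y h" and \<U>: "finite_open_cover X \<U>"
  shows "finite_open_cover Y ((`) h ` \<U>)"
  unfolding finite_open_cover_def
proof (intro conjI ballI)
  show "finite ((`) h ` \<U>)" using \<U> by (simp add: finite_open_cover_def)
  show "openin Y W" if "W \<in> (`) h ` \<U>" for W
    using that \<U> homeomorphic_imp_open_map[OF h] by (auto simp: finite_open_cover_def open_map_def)
  have "\<Union> ((`) h ` \<U>) = h ` \<Union>\<U>" by blast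
  also have "\<dots> = topspace Y"
    using \<U> homeomorphic_imp_surjective_map[OF h] by (simp add: finite_open_cover_def)
  finally show "\<Union> ((`) h ` \<U>) = topspace Y" .
qed

lemma refinable_homeomorphic_space:
  assumes "X homeomorphic_space Y" "refinable X k"
  shows "refinable Y k"
  unfolding refinable_def
proof (intro allI impI)
  fix \<U> assume \<U>: "finite_open_cover Y \<U>"
  obtain h g where hg: "homeomorphic_maps X Y h g"
    using assms(1) by (auto simp: homeomorphic_space_def)
  then have h: "homeomorphic_map X Y h" and g: "homeomorphic_map Y X g"
    and hgy: "\<And>y. y \<in> topspace Y \<Longrightarrow> h (g y) = y" and ghx: "\<And>x. x \<in> topspace X \<Longrightarrow> g (h x) = x"
    by (auto simp: homeomorphic_maps_map)
  have gX: "g y \<in> topspace X" if "y \<in> topspace Y" for y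
    using homeomorphic_imp_surjective_map[OF g] that by blast
  obtain \<V> where \<V>: "finite_open_cover X \<V>" "\<forall>V\<in>\<V>. \<exists>U\<in>(`) g ` \<U>. V \<subseteq> U"
    "\<forall>x\<in>topspace X. card {V\<in>\<V>. x \<in> V} \<le> k"
    using assms(2) homeomorphic_map_finite_open_cover[OF g \<U>] unfolding refinable_def by meson
  have subX: "V \<subseteq> topspace X" if "V \<in> \<V>" for V
    using \<V>(1) that by (auto simp: finite_open_cover_def)
  have subY: "U \<subseteq> topspace Y" if "U \<in> \<U>" for U
    using \<U> that by (auto simp: finite_open_cover_def)
  have "\<exists>U\<in>\<U>. h ` V \<subseteq> U" if V: "V \<in> \<V>" for V
  proof -
    obtain U where "U \<in> \<U>" "V \<subseteq> g ` U" using \<V>(2) V by blast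
    moreover from this have "h ` V \<subseteq> U"
      using subY[of U] hgy by (force simp: subset_iff)
    ultimately show ?thesis by blast
  qed
  moreover have "card {W \<in> (`) h ` \<V>. y \<in> W} \<le> k" if y: "y \<in> topspace Y" for y
  proof -
    have "{W \<in> (`) h ` \<V>. y \<in> W} \<subseteq> (`) h ` {V\<in>\<V>. g y \<in> V}"
      using subX ghx by (auto simp: subset_iff)
    moreover have "finite {V\<in>\<V>. g y \<in> V}"
      using \<V>(1) by (simp add: finite_open_cover_def)
    ultimately have "card {W \<in> (`) h ` \<V>. y \<in> W} \<le> card {V\<in>\<V>. g y \<in> V}"
      using surj_card_le by blast
    then show ?thesis using \<V>(3) gX[OF y] by (meson le_trans)
  qed
  ultimately show "\<exists>\<V>. finite_open_cover Y \<V> \<and> (\<forall>V\<in>\<V>. \<exists>U\<in>\<U>. V \<subseteq> U) \<and>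
      (\<forall>x\<in>topspace Y. card {V \<in> \<V>. x \<in> V} \<le> k)"
    using homeomorphic_map_finite_open_cover[OF h \<V>(1)] by blast
qed

lemma covering_dim_homeomorphic_space:
  assumes "X homeomorphic_space Y" shows "covering_dim X = covering_dim Y"
proof -
  have "refinable X k \<longleftrightarrow> refinable Y k" for k
    using assms refinable_homeomorphic_space[of X Y k] refinable_homeomorphic_space[of Y X k]
      homeomorphic_space_sym[of X Y] by blast
  then show ?thesis by (simp add: covering_dim_eq)
qed

text \<open>The map \<open>u\<close> is continuous for the pullback topology by construction, and
  its inverse is continuous because following it by \<open>u\<close> gives the identity. This copies
  a topology from one type to another.\<close>

lemma homeomorphic_map_inv_pullback_topology:
  assumes "bij u"
  shows "homeomorphic_map T (pullback_topology UNIV u T) (inv_into UNIV u)"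
proof -
  have u: "surj u" "\<And>x. u (inv_into UNIV u x) = x" "\<And>x. inv_into UNIV u (u x) = x"
    using assms by (auto simp: bij_def surj_f_inv_f)
  have cont: "continuous_map (pullback_topology UNIV u T) T u"
    using continuous_map_pullback[of T T id UNIV u] by simp
  have "continuous_map T (pullback_topology UNIV u T) (inv_into UNIV u)"
    by (rule continuous_map_pullback') (auto simp: u o_def)
  with cont have "homeomorphic_maps T (pullback_topology UNIV u T) (inv_into UNIV u) u"
    by (simp add: homeomorphic_maps_def u)
  then show ?thesis by (simp add: homeomorphic_maps_map)
qed

text \<open>Even and odd coordinates identify \<open>nat \<Rightarrow> real\<close> with its square.
  Width dimensions only admit target spaces on that type, so a product of two targets has to be
  moved back to it.\<close>

lemma bij_interleave: "bij (\<lambda>f :: nat \<Rightarrow> 'a. (\<lambda>n. f (2 * n), \<lambda>n. f (2 * n + 1)))"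
proof (rule o_bij)
  let ?u = "\<lambda>f :: nat \<Rightarrow> 'a. (\<lambda>n. f (2 * n), \<lambda>n. f (2 * n + 1))"
  let ?g = "\<lambda>(a, b) n. if even n then a (n div 2) else b (n div 2) :: 'a"
  show "?g \<circ> ?u = id"
    by (auto simp: fun_eq_iff elim!: oddE)
  show "?u \<circ> ?g = id"
    by (auto simp: fun_eq_iff)
qed

section \<open>Subadditivity of width dimension\<close>

lemma Wdim_rel_ge: "- 1 \<le> Wdim_rel \<epsilon> K \<theta> \<rho> \<rho>'"
  unfolding Wdim_rel_def by (intro INF_greatest covering_dim_ge)

lemma Wdim_ge: "- 1 \<le> Wdim \<epsilon> K \<rho>"
  unfolding Wdim_def by (intro INF_greatest covering_dim_ge)

text \<open>The spaces \<open>K'\<close> and \<open>L\<close> are kept separate from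
  \<open>K\<close> so that the two widths on the right may belong to different microstate
  parameters. The number \<open>\<theta>\<close> is the tolerance of the relative width and at the
  same time the scale of the width of \<open>L\<close>.\<close>

lemma Wdim_le_Wdim_rel_add_Wdim:
  assumes p: "continuous_map K L p" and id: "continuous_map K K' id"
    and \<rho>': "\<And>x y. \<lbrakk>x \<in> topspace K; y \<in> topspace K\<rbrakk> \<Longrightarrow> \<rho>' x y \<le> \<rho>'' (p x) (p y)"
  shows "Wdim \<epsilon> K \<rho> \<le> Wdim_rel \<epsilon> K' \<theta> \<rho> \<rho>' + Wdim \<theta> L \<rho>'' + 1"
proof -
  define u where "u = (\<lambda>f :: nat \<Rightarrow> real. (\<lambda>n. f (2 * n), \<lambda>n. f (2 * n + 1)))"
  have u: "bij u" unfolding u_def by (rule bij_interleave)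
  have "Wdim \<epsilon> K \<rho> - 1 \<le> Wdim_rel \<epsilon> K' \<theta> \<rho> \<rho>' + Wdim \<theta> L \<rho>''"
    unfolding Wdim_rel_def Wdim_def[of \<theta>]
  proof (rule le_Inf_add_Inf[where c = "- 1"]; clarify)
    fix P Q :: "(nat \<Rightarrow> real) topology" and f g
    assume P: "compact_space P" "metrizable_space P" and f: "continuous_map K' P f"
      "\<forall>x\<in>topspace K'. \<forall>y\<in>topspace K'. f x = f y \<and> \<rho>' x y \<le> \<theta> \<longrightarrow> \<rho> x y < \<epsilon>"
    assume Q: "compact_space Q" "metrizable_space Q" and g: "continuous_map L Q g"
      "\<forall>x\<in>topspace L. \<forall>y\<in>topspace L. g x = g y \<longrightarrow> \<rho>'' x y < \<theta>"
    \<comment> \<open>The copy of the product of \<open>P\<close> and \<open>Q\<close> on the type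
      \<open>nat \<Rightarrow> real\<close>.\<close>
    define R where "R = pullback_topology UNIV u (prod_topology P Q)"
    have inv: "homeomorphic_map (prod_topology P Q) R (inv_into UNIV u)"
      unfolding R_def by (rule homeomorphic_map_inv_pullback_topology[OF u])
    then have hom: "prod_topology P Q homeomorphic_space R"
      by (rule homeomorphic_map_imp_homeomorphic_space)
    define h where "h x = inv_into UNIV u (f x, g (p x))" for x
    have "continuous_map K (prod_topology P Q) (\<lambda>x. (f x, g (p x)))"
      using continuous_map_compose[OF id f(1)] continuous_map_compose[OF p g(1)]
      by (simp add: continuous_map_pairedI o_def)
    then have "continuous_map K R h"
      using continuous_map_compose[OF _ homeomorphic_imp_continuous_map[OF inv]]
      unfolding h_def o_def by blast
    moreover have "\<rho> x y < \<epsilon>" if xy: "x \<in> topspace K" "y \<in> topspace K" "h x = h y" for x y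
    proof -
      have eq: "f x = f y" "g (p x) = g (p y)"
        using xy(3) bij_imp_bij_inv[OF u] by (auto simp: h_def bij_def inj_eq)
      have mem: "p x \<in> topspace L" "p y \<in> topspace L" "x \<in> topspace K'" "y \<in> topspace K'"
        using p id xy by (auto simp: continuous_map_def)
      \<comment> \<open>Agreement under \<open>g\<close> brings the projections within
        \<open>\<theta>\<close>, which is the condition under which \<open>f\<close> controls
        \<open>\<rho>\<close>.\<close>
      then have "\<rho>' x y \<le> \<theta>"
        using g(2) eq(2) \<rho>'[OF xy(1,2)] by fastforce
      then show ?thesis
        using f(2) eq(1) mem by blast
    qed
    moreover have "compact_space R" "metrizable_space R"
      using homeomorphic_compact_space[OF hom] homeomorphic_metrizable_space[OF hom] P Q
      by (simp_all add: compact_space_prod_topology metrizable_space_prod_topology)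
    ultimately have "Wdim \<epsilon> K \<rho> \<le> covering_dim R"
      unfolding Wdim_def by (intro INF_lower) auto
    also have "\<dots> \<le> covering_dim P + covering_dim Q + 1"
      using covering_dim_prod_le[OF P Q] covering_dim_homeomorphic_space[OF hom] by simp
    finally show "Wdim \<epsilon> K \<rho> - 1 \<le> covering_dim P + covering_dim Q"
      by (simp add: ereal_minus_le)
  qed (use covering_dim_ge in \<open>simp_all add: one_ereal_def\<close>)
  then show ?thesis by (simp add: ereal_minus_le)
qed

section \<open>Microstates and their projections\<close>

lemma Map_set_mono:
  assumes "F' \<subseteq> F" "\<delta> \<le> \<delta>'"
  shows "Map_set X \<alpha> \<rho> F \<delta> n \<sigma> \<subseteq> Map_set X \<alpha> \<rho> F' \<delta>' n \<sigma>"
  using assms by (force simp: Map_set_def)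

lemma continuous_map_compose_power_space:
  assumes "continuous_map X Y \<pi>"
  shows "continuous_map (power_space X n) (power_space Y n) (compose {1..n} \<pi>)"
  unfolding continuous_map_componentwise
proof (intro conjI ballI)
  fix v assume v: "v \<in> {1..n}"
  have "continuous_map (power_space X n) Y (\<pi> \<circ> (\<lambda>\<phi>. \<phi> v))"
    using assms v by (intro continuous_map_compose[OF continuous_map_product_projection]) auto
  then show "continuous_map (power_space X n) Y (\<lambda>\<phi>. compose {1..n} \<pi> \<phi> v)"
    using v by (simp add: compose_def o_def)
qed auto

text \<open>The two compositions agree on \<open>{1..n}\<close>, the only indices
  \<open>dist_inf\<close> sees. This matches the metric in \<open>mdim_ext\<close> with the
  pseudometric in \<open>mdim_rel\<close>.\<close>

lemma dist_inf_compose: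
  "dist_inf \<rho> n (compose {1..n} \<pi> \<phi>) (compose {1..n} \<pi> \<psi>) = dist_inf \<rho> n (\<pi> \<circ> \<phi>) (\<pi> \<circ> \<psi>)"
  unfolding dist_inf_def by (intro arg_cong[where f = Max] image_cong) (auto simp: compose_def)

text \<open>Microstates for the stricter pair \<open>F\<close>, \<open>\<delta>\<close> are
  microstates for both weaker pairs, so they include into the first set and project into the
  second.\<close>

lemma Wdim_Map_set_le:
  assumes \<pi>: "continuous_map X Y \<pi>" and "F1 \<subseteq> F" "\<delta> \<le> \<delta>1" "F2 \<subseteq> F" "\<delta> \<le> \<delta>2"
  shows "Wdim \<epsilon> (subtopology (power_space X n) (Map_set X \<alpha> \<rho>X F \<delta> n \<sigma>)) (dist_inf \<rho>X n)
    \<le> Wdim_rel \<epsilon> (subtopology (power_space X n) (Map_set X \<alpha> \<rho>X F1 \<delta>1 n \<sigma>)) \<theta> (dist_inf \<rho>X n)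
          (\<lambda>\<phi> \<psi>. dist_inf \<rho>Y n (\<pi> \<circ> \<phi>) (\<pi> \<circ> \<psi>))
      + Wdim \<theta> (subtopology (power_space Y n) (compose {1..n} \<pi> ` Map_set X \<alpha> \<rho>X F2 \<delta>2 n \<sigma>))
          (dist_inf \<rho>Y n)
      + 1"
proof (rule Wdim_le_Wdim_rel_add_Wdim)
  let ?M = "\<lambda>F \<delta>. Map_set X \<alpha> \<rho>X F \<delta> n \<sigma>"
  have sub: "?M F \<delta> \<subseteq> ?M F1 \<delta>1" "?M F \<delta> \<subseteq> ?M F2 \<delta>2"
    using assms by (simp_all add: Map_set_mono)
  show "continuous_map (subtopology (power_space X n) (?M F \<delta>))
      (subtopology (power_space Y n) (compose {1..n} \<pi> ` ?M F2 \<delta>2)) (compose {1..n} \<pi>)"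
    using continuous_map_compose_power_space[OF \<pi>, of n] sub(2)
    by (auto simp: continuous_map_in_subtopology continuous_map_from_subtopology)
  show "continuous_map (subtopology (power_space X n) (?M F \<delta>))
      (subtopology (power_space X n) (?M F1 \<delta>1)) id"
    using sub(1) by (auto simp: continuous_map_in_subtopology continuous_map_from_subtopology)
qed (simp only: dist_inf_compose order_refl)

section \<open>Normalized upper limits\<close>

lemma normalized_ge:
  fixes w :: ereal
  assumes "- 1 \<le> w" "1 \<le> n"
  shows "- 1 \<le> ereal (1 / real n) * w"
proof -
  have "(- 1 :: ereal) \<le> ereal (1 / real n) * (- 1)"
    using assms(2) by (simp add: one_ereal_def)
  also have "\<dots> \<le> ereal (1 / real n) * w"
    using assms by (intro ereal_mult_left_mono) auto
  finally show ?thesis .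
qed

text \<open>After normalization the additive constant 1 becomes \<open>1 / d i\<close>, which tends
  to 0.\<close>

lemma limsup_normalized_add:
  fixes a b c :: "nat \<Rightarrow> ereal"
  assumes le: "\<And>i. a i \<le> b i + c i + 1" and d: "filterlim d at_top sequentially"
  shows "limsup (\<lambda>i. ereal (1 / real (d i)) * a i)
    \<le> limsup (\<lambda>i. ereal (1 / real (d i)) * b i) + limsup (\<lambda>i. ereal (1 / real (d i)) * c i)"
proof -
  let ?r = "\<lambda>i. ereal (1 / real (d i))"
  have "filterlim (\<lambda>i. real (d i)) at_top sequentially"
    using d filterlim_compose filterlim_real_sequentially by blast
  then have "(\<lambda>i. 1 / real (d i)) \<longlonglongrightarrow> 0"
    using tendsto_inverse_0_at_top by (simp add: divide_inverse)
  then have r0: "limsup ?r = 0"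
    by (intro lim_imp_Limsup) (auto simp: zero_ereal_def)
  have "?r i * a i \<le> ?r i * b i + ?r i * c i + ?r i" for i
  proof -
    have "?r i * a i \<le> ?r i * (b i + c i + 1)"
      by (intro ereal_mult_left_mono le) auto
    also have "\<dots> = ?r i * b i + ?r i * c i + ?r i"
      by (simp add: ereal_pos_distrib)
    finally show ?thesis .
  qed
  then have "limsup (\<lambda>i. ?r i * a i) \<le> limsup (\<lambda>i. ?r i * b i + ?r i * c i + ?r i)"
    by (intro Limsup_mono) auto
  also have "\<dots> \<le> limsup (\<lambda>i. ?r i * b i + ?r i * c i) + limsup ?r"
    by (rule ereal_limsup_add_mono)
  also have "\<dots> \<le> limsup (\<lambda>i. ?r i * b i) + limsup (\<lambda>i. ?r i * c i)"
    using ereal_limsup_add_mono[of "\<lambda>i. ?r i * b i" "\<lambda>i. ?r i * c i"] by (simp add: r0)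
  finally show ?thesis .
qed

theorem theorem4p10:
  fixes \<Gamma> :: "('g, 'm) monoid_scheme"
    and d :: "nat \<Rightarrow> nat" and \<sigma> :: "nat \<Rightarrow> 'g \<Rightarrow> nat \<Rightarrow> nat"
    and X :: "'x topology" and \<alpha> :: "'g \<Rightarrow> 'x \<Rightarrow> 'x" and \<rho>X :: "'x \<Rightarrow> 'x \<Rightarrow> real"
    and Y :: "'y topology" and \<beta> :: "'g \<Rightarrow> 'y \<Rightarrow> 'y" and \<rho>Y :: "'y \<Rightarrow> 'y \<Rightarrow> real"
    and \<pi> :: "'x \<Rightarrow> 'y"
  assumes "group \<Gamma>" and "countable (carrier \<Gamma>)"
    and "sofic_approximation \<Gamma> d \<sigma>"
    and "dynamical_system \<Gamma> X \<alpha>" and "dynamical_system \<Gamma> Y \<beta>"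
    and "factor_map \<Gamma> X \<alpha> Y \<beta> \<pi>"
    and "compatible_metric X \<rho>X" and "compatible_metric Y \<rho>Y"
  shows "mdim \<Gamma> d \<sigma> X \<alpha> \<rho>X
           \<le> mdim_rel \<Gamma> d \<sigma> X \<alpha> \<rho>X \<rho>Y \<pi> + mdim_ext \<Gamma> d \<sigma> X \<alpha> \<rho>X Y \<rho>Y \<pi>"
proof -
  have d: "\<And>i. 1 \<le> d i" "filterlim d at_top sequentially"
    using assms(3) by (auto simp: sofic_approximation_def)
  have \<pi>: "continuous_map X Y \<pi>" using assms(6) by (simp add: factor_map_def)
  define M where "M F \<delta> i = Map_set X \<alpha> \<rho>X F \<delta> (d i) (\<sigma> i)" for F \<delta> i
  let ?r = "\<lambda>i. ereal (1 / real (d i))"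
  define A where "A \<epsilon> F \<delta> i =
    Wdim \<epsilon> (subtopology (power_space X (d i)) (M F \<delta> i)) (dist_inf \<rho>X (d i))" for \<epsilon> F \<delta> i
  define R where "R \<epsilon> \<theta> F \<delta> i =
    Wdim_rel \<epsilon> (subtopology (power_space X (d i)) (M F \<delta> i)) \<theta> (dist_inf \<rho>X (d i))
      (\<lambda>\<phi> \<psi>. dist_inf \<rho>Y (d i) (\<pi> \<circ> \<phi>) (\<pi> \<circ> \<psi>))" for \<epsilon> \<theta> F \<delta> i
  define E where "E \<theta> F \<delta> i =
    Wdim \<theta> (subtopology (power_space Y (d i)) (compose {1..d i} \<pi> ` M F \<delta> i)) (dist_inf \<rho>Y (d i))"
    for \<theta> F \<delta> i
  let ?lA = "\<lambda>\<epsilon> F \<delta>. limsup (\<lambda>i. ?r i * A \<epsilon> F \<delta> i)"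
  let ?lR = "\<lambda>\<epsilon> \<theta> F \<delta>. limsup (\<lambda>i. ?r i * R \<epsilon> \<theta> F \<delta> i)"
  let ?lE = "\<lambda>\<theta> F \<delta>. limsup (\<lambda>i. ?r i * E \<theta> F \<delta> i)"
  have mdim: "mdim \<Gamma> d \<sigma> X \<alpha> \<rho>X = (SUP \<epsilon>\<in>{0<..}. INF F\<in>fin_subsets \<Gamma>. INF \<delta>\<in>{0<..}.
      limsup_Map (M F \<delta>) (\<lambda>i. ?r i * A \<epsilon> F \<delta> i))"
    by (simp add: mdim_def M_def[abs_def] A_def)
  show ?thesis
  \<comment> \<open>The convention for empty microstate sets refers to the same sets in all three
    quantities. If they are eventually empty for one pair \<open>F\<close>, \<open>\<delta>\<close>,
    the infimum makes the left side \<open>- \<infinity>\<close>; otherwise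
    \<open>limsup_Map\<close> is the plain upper limit throughout.\<close>
  proof (cases "\<exists>F\<in>fin_subsets \<Gamma>. \<exists>\<delta>>0. \<forall>\<^sub>F i in sequentially. M F \<delta> i = {}")
    case True
    then obtain F \<delta> where "F \<in> fin_subsets \<Gamma>" "\<delta> > 0" "\<forall>\<^sub>F i in sequentially. M F \<delta> i = {}"
      by blast
    then have "mdim \<Gamma> d \<sigma> X \<alpha> \<rho>X \<le> - \<infinity>"
      unfolding mdim by (intro SUP_least INF_lower2[of F] INF_lower2[of \<delta>]) (auto simp: limsup_Map_def)
    then show ?thesis by simp
  next
    case False
    have ls: "limsup_Map (M F \<delta>) w = limsup w" if "F \<in> fin_subsets \<Gamma>" "0 < \<delta>" for F \<delta> w
      using False that by (auto simp: limsup_Map_def)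
    have mrel: "mdim_rel \<Gamma> d \<sigma> X \<alpha> \<rho>X \<rho>Y \<pi> =
        (SUP \<epsilon>\<in>{0<..}. INF \<theta>\<in>{0<..}. INF F\<in>fin_subsets \<Gamma>. INF \<delta>\<in>{0<..}. ?lR \<epsilon> \<theta> F \<delta>)"
      unfolding mdim_rel_def by (intro SUP_cong INF_cong refl) (simp add: ls del: One_nat_def flip: M_def R_def)
    have mext: "mdim_ext \<Gamma> d \<sigma> X \<alpha> \<rho>X Y \<rho>Y \<pi> =
        (SUP \<theta>\<in>{0<..}. INF F\<in>fin_subsets \<Gamma>. INF \<delta>\<in>{0<..}. ?lE \<theta> F \<delta>)"
      unfolding mdim_ext_def by (intro SUP_cong INF_cong refl) (simp add: ls del: One_nat_def flip: M_def E_def)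
    have R_ge: "ereal (- 1) \<le> ?lR \<epsilon> \<theta> F \<delta>" for \<epsilon> \<theta> F \<delta>
      using normalized_ge[OF Wdim_rel_ge d(1)]
      by (intro le_Limsup always_eventually allI) (simp_all add: R_def one_ereal_def)
    have E_ge: "ereal (- 1) \<le> ?lE \<theta> F \<delta>" for \<theta> F \<delta>
      using normalized_ge[OF Wdim_ge d(1)]
      by (intro le_Limsup always_eventually allI) (simp_all add: E_def one_ereal_def)
    have ext_ge: "ereal (- 1) \<le> mdim_ext \<Gamma> d \<sigma> X \<alpha> \<rho>X Y \<rho>Y \<pi>"
      unfolding mext by (intro SUP_upper2[of 1] INF_greatest E_ge) auto
    show ?thesis
      unfolding mdim
    proof (rule SUP_least)
      fix \<epsilon> :: real assume \<epsilon>: "\<epsilon> \<in> {0<..}"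
      let ?m = "INF F\<in>fin_subsets \<Gamma>. INF \<delta>\<in>{0<..}. limsup_Map (M F \<delta>) (\<lambda>i. ?r i * A \<epsilon> F \<delta> i)"
      \<comment> \<open>The union of the finite sets and the minimum of the tolerances serve both
        summands, whose parameters can therefore vary independently for a common
        \<open>\<theta>\<close>.\<close>
      have m_le: "?m \<le> ?lR \<epsilon> \<theta> F1 \<delta>1 + ?lE \<theta> F2 \<delta>2"
        if "F1 \<in> fin_subsets \<Gamma>" "0 < \<delta>1" "F2 \<in> fin_subsets \<Gamma>" "0 < \<delta>2" for \<theta> F1 \<delta>1 F2 \<delta>2
      proof -
        let ?F = "F1 \<union> F2" and ?\<delta> = "min \<delta>1 \<delta>2"
        have F: "?F \<in> fin_subsets \<Gamma>" "0 < ?\<delta>" using that by (auto simp: fin_subsets_def)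
        then have "?m \<le> ?lA \<epsilon> ?F ?\<delta>"
          by (intro INF_lower2[of ?F] INF_lower2[of ?\<delta>]) (auto simp: ls)
        also have "\<dots> \<le> ?lR \<epsilon> \<theta> F1 \<delta>1 + ?lE \<theta> F2 \<delta>2"
          unfolding A_def R_def E_def M_def
          by (intro limsup_normalized_add Wdim_Map_set_le \<pi> d(2)) auto
        finally show ?thesis .
      qed
      \<comment> \<open>On the right \<open>\<theta>\<close> is minimized in the first summand but
        is the scale of a supremum in the second. So \<open>\<theta>\<close> stays fixed while the
        infimum over the second pair is taken, and the result is then bounded by the supremum
        \<open>mdim_ext\<close>.\<close>
      have m_le_ext: "?m \<le> ?lR \<epsilon> \<theta> F1 \<delta>1 + mdim_ext \<Gamma> d \<sigma> X \<alpha> \<rho>X Y \<rho>Y \<pi>"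
        if "F1 \<in> fin_subsets \<Gamma>" "0 < \<delta>1" "0 < \<theta>" for \<theta> F1 \<delta>1
      proof -
        \<comment> \<open>The singleton only gives the sum the shape of
          \<open>le_Inf_add_Inf\<close>.\<close>
        have "?m \<le> Inf {?lR \<epsilon> \<theta> F1 \<delta>1} + Inf ((\<lambda>(F, \<delta>). ?lE \<theta> F \<delta>) ` (fin_subsets \<Gamma> \<times> {0<..}))"
          using m_le that R_ge E_ge by (intro le_Inf_add_Inf[where c = "- 1"]) auto
        also have "\<dots> \<le> ?lR \<epsilon> \<theta> F1 \<delta>1 + mdim_ext \<Gamma> d \<sigma> X \<alpha> \<rho>X Y \<rho>Y \<pi>"
          unfolding mext using that
          by (intro add_mono SUP_upper2[of \<theta>] INF_greatest Inf_lower) (auto intro: rev_image_eqI)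
        finally show ?thesis .
      qed
      \<comment> \<open>The second summand is now independent of \<open>\<theta>\<close>, so the
        infimum over \<open>\<theta>\<close>, \<open>F\<close> and \<open>\<delta>\<close> can be
        taken in the first alone.\<close>
      have "?m \<le> Inf {?lR \<epsilon> \<theta> F \<delta> |\<theta> F \<delta>. 0 < \<theta> \<and> F \<in> fin_subsets \<Gamma> \<and> 0 < \<delta>}
          + Inf {mdim_ext \<Gamma> d \<sigma> X \<alpha> \<rho>X Y \<rho>Y \<pi>}"
        using m_le_ext R_ge ext_ge
        by (intro le_Inf_add_Inf[where c = "- 1"]) auto
      also have "\<dots> \<le> mdim_rel \<Gamma> d \<sigma> X \<alpha> \<rho>X \<rho>Y \<pi> + mdim_ext \<Gamma> d \<sigma> X \<alpha> \<rho>X Y \<rho>Y \<pi>"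
        unfolding mrel using \<epsilon>
        by (intro add_mono SUP_upper2[of \<epsilon>] INF_greatest Inf_lower) auto
      finally show "?m \<le> mdim_rel \<Gamma> d \<sigma> X \<alpha> \<rho>X \<rho>Y \<pi> + mdim_ext \<Gamma> d \<sigma> X \<alpha> \<rho>X Y \<rho>Y \<pi>" .
    qed
  qed
qed

end
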